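(* Let $\pi$ be an inaccessible cardinal. Then the following are equivalent: (1) $\pi$ is subtle. (2) For every $\mathcal{A} \subseteq V_\pi$, the set of $\kappa < \pi$ which are $\mathcal{A}$-$<\pi$-shrewd is stationary in $\pi$.
   Context: We work in $\mathsf{ZFC}$; $V_\alpha$ denotes the $\alpha$-th level of the cumulative hierarchy. An inaccessible cardinal is a strongly inaccessible one (uncountable, regular, strong limit). Subtle: a cardinal $\pi$ is called subtle iff for any sequence $\langle S_\alpha : \alpha < \pi\rangle$ with $S_\alpha \subseteq \alpha$ for all $\alpha<\pi$, and any club $C$ in $\pi$, there are $\beta,\delta \in C$ with $\beta<\delta$ and $S_\delta \cap \beta = S_\beta$. Shrewdness: let $\mathcal{A}$ be a class and $\eta > 0$ an ordinal. A cardinal $\kappa$ is $\mathcal{A}$-$\eta$-shrewd iff for all $P \subseteq V_\kappa$ and every formula $\varphi(x)$ in the first-order language of set theory with two additional unary predicate symbols, if $(V_{\kappa+\eta}, \in, P, \mathcal{A}\cap V_{\kappa+\eta}) \models \varphi(\kappa)$, then there exist ordinals $0<\kappa_0,\eta_0<\kappa$ such that $(V_{\kappa_0+\eta_0}, \in, P\cap V_{\kappa_0}, \mathcal{A}\cap V_{\kappa_0+\eta_0}) \models \varphi(\kappa_0)$. A cardinal $\kappa$ is $\mathcal{A}$-$<\pi$-shrewd iff it is $\mathcal{A}$-$\eta$-shrewd for all $0<\eta<\pi$. *)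

theory Defs
  imports Main "HOL-Library.Equipollence" "HOL-Library.Countable_Set"
begin

text \<open>
  HOL has no type of ZFC sets, so the ambient universe is a type \<open>'v\<close> with an extension map
  \<open>elts\<close> satisfying the ZFC axioms: \<open>x \<in> elts y\<close> is the membership relation of the universe.
  Replacement is stated for arbitrary HOL functions. HOL sets \<open>'v set\<close> play the role of classes,
  and every subclass of a set of the universe is (the extension of) a set, see \<open>separation\<close>.
  The axiom of choice is inherited from HOL, see \<open>choice\<close>.
\<close>

class zfc =
  fixes elts :: "'a \<Rightarrow> 'a set"
  assumes extensionality: "elts x = elts y \<Longrightarrow> x = y"
    and foundation: "elts x \<noteq> {} \<Longrightarrow> \<exists>y\<in>elts x. elts y \<inter> elts x = {}"
    and pairing: "\<exists>z. elts z = {x, y}"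
    and union: "\<exists>u. elts u = (\<Union>y\<in>elts x. elts y)"
    and powerset: "\<exists>p. elts p = {y. elts y \<subseteq> elts x}"
    and infinity: "\<exists>w. (\<exists>e\<in>elts w. elts e = {}) \<and>
                       (\<forall>x\<in>elts w. \<exists>y\<in>elts w. elts y = insert x (elts x))"
    and replacement: "\<exists>y. elts y = F ` elts x"

lemma separation:
  fixes x :: "'v::zfc"
  assumes "X \<subseteq> elts x"
  shows "\<exists>y. elts y = X"
proof (cases "X = {}")
  case True
  then show ?thesis using infinity by metis
next
  case False
  then obtain d where d: "d \<in> X" by blast
  obtain y where "elts y = (\<lambda>z. if z \<in> X then z else d) ` elts x"
    using replacement by blast
  moreover have "(\<lambda>z. if z \<in> X then z else d) ` elts x = X"
    using assms d by (auto simp: image_iff)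
  ultimately show ?thesis by blast
qed

lemma choice:
  fixes x :: "'v::zfc"
  assumes "\<And>y. y \<in> elts x \<Longrightarrow> elts y \<noteq> {}"
    and disj: "\<And>y z. \<lbrakk>y \<in> elts x; z \<in> elts x; y \<noteq> z\<rbrakk> \<Longrightarrow> elts y \<inter> elts z = {}"
  shows "\<exists>c. \<forall>y\<in>elts x. \<exists>!a. a \<in> elts c \<inter> elts y"
proof -
  define f where "f y = (SOME a. a \<in> elts y)" for y :: 'v
  have f: "f y \<in> elts y" if "y \<in> elts x" for y
    unfolding f_def using assms(1)[OF that] by (simp add: some_in_eq)
  obtain c where c: "elts c = f ` elts x"
    using replacement by blast
  have "\<exists>!a. a \<in> elts c \<inter> elts y" if y: "y \<in> elts x" for y
  proof
    show "f y \<in> elts c \<inter> elts y" using c f y by blast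
  next
    fix a assume a: "a \<in> elts c \<inter> elts y"
    then obtain z where "z \<in> elts x" "a = f z" using c by blast
    then show "a = f y" using a f y disj[of z y] by blast
  qed
  then show ?thesis by blast
qed

text \<open>The set with extension \<open>X\<close>; meaningful only if \<open>X\<close> is not a proper class.\<close>

definition vset :: "'v set \<Rightarrow> 'v::zfc" where
  "vset X = (THE x. elts x = X)"

lemma vset_elts [simp]: "vset (elts x) = x"
  unfolding vset_def by (blast intro: extensionality)

lemma elts_vset: "X \<subseteq> elts x \<Longrightarrow> elts (vset X) = X"
  by (metis separation vset_elts)


definition mem_rel :: "('v::zfc \<times> 'v) set" where
  "mem_rel = {(x, y). x \<in> elts y}"

lemma mem_rel_iff [simp]: "(x, y) \<in> mem_rel \<longleftrightarrow> x \<in> elts y"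
  by (simp add: mem_rel_def)

lemma not_mem_self: "(x::'v::zfc) \<notin> elts x"
proof -
  obtain z where "elts z = {x}" using pairing[of x x] by auto
  then show ?thesis using foundation[of z] by simp
qed

lemma countable_range_set:
  fixes g :: "nat \<Rightarrow> 'v::zfc"
  shows "\<exists>y. elts y = range g"
proof -
  obtain w :: 'v where w: "(\<exists>e\<in>elts w. elts e = {}) \<and>
      (\<forall>x\<in>elts w. \<exists>y\<in>elts w. elts y = insert x (elts x))"
    using infinity by (elim exE)
  then obtain e where e: "e \<in> elts w" by (elim conjE bexE)
  obtain s where "\<forall>x\<in>elts w. s x \<in> elts w \<and> elts (s x) = insert x (elts x)"
    using bchoice[OF w[THEN conjunct2, unfolded Bex_def]] by (elim exE)
  then have s: "s x \<in> elts w \<and> elts (s x) = insert x (elts x)" if "x \<in> elts w" for x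
    using that by (rule bspec)
  define N where "N n = (s ^^ n) e" for n
  have Nw: "N n \<in> elts w" for n
    by (induction n) (simp_all add: N_def e s)
  have NSuc: "elts (N (Suc n)) = insert (N n) (elts (N n))" for n
    using s[OF Nw[of n]] by (simp add: N_def)
  have less: "m < n \<Longrightarrow> N m \<in> elts (N n)" for m n
    by (induction n) (auto simp: NSuc less_Suc_eq)
  have "inj N"
  proof (rule injI)
    fix m n assume "N m = N n"
    then show "m = n"
      using less[of m n] less[of n m] not_mem_self[of "N n"] by (cases m n rule: linorder_cases) simp_all
  qed
  obtain y where y: "elts y = (g \<circ> inv N) ` elts w"
    using replacement[of "g \<circ> inv N" w] by (elim exE)
  have "g n \<in> elts y" for n
    unfolding y by (rule image_eqI[OF _ Nw[of n]]) (simp add: inv_f_f[OF \<open>inj N\<close>])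
  then have "range g \<subseteq> elts y" by (rule image_subsetI)
  then show ?thesis by (rule separation)
qed

lemma wf_mem_rel: "wf (mem_rel :: ('v::zfc \<times> 'v) set)"
  unfolding wf_iff_no_infinite_down_chain
proof
  assume "\<exists>g. \<forall>i. (g (Suc i), g i) \<in> (mem_rel :: ('v \<times> 'v) set)"
  then obtain g :: "nat \<Rightarrow> 'v" where g: "\<And>i. g (Suc i) \<in> elts (g i)" by auto
  obtain y where y: "elts y = range g" using countable_range_set[of g] by (elim exE)
  then obtain i where i: "elts (g i) \<inter> range g = {}" using foundation[of y] by auto
  show False using g[of i] i by auto
qed


definition Ord :: "'v::zfc \<Rightarrow> bool" where
  "Ord \<alpha> \<longleftrightarrow> (\<forall>x\<in>elts \<alpha>. elts x \<subseteq> elts \<alpha>) \<and> (\<forall>x\<in>elts \<alpha>. \<forall>y\<in>elts x. elts y \<subseteq> elts x)"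

text \<open>Ordinals are von Neumann ordinals: \<open>\<beta> < \<alpha>\<close> is written \<open>\<beta> \<in> elts \<alpha>\<close>, \<open>\<beta> \<le> \<alpha>\<close> is written
  \<open>elts \<beta> \<subseteq> elts \<alpha>\<close>, and \<open>0 < \<alpha>\<close> is written \<open>elts \<alpha> \<noteq> {}\<close>.\<close>

definition Limit :: "'v::zfc \<Rightarrow> bool" where
  "Limit \<alpha> \<longleftrightarrow> Ord \<alpha> \<and> elts \<alpha> \<noteq> {} \<and> (\<forall>\<beta>\<in>elts \<alpha>. \<exists>\<gamma>\<in>elts \<alpha>. \<beta> \<in> elts \<gamma>)"

definition Vlevel :: "'v::zfc \<Rightarrow> 'v" where
  "Vlevel = wfrec mem_rel (\<lambda>V \<alpha>. vset (\<Union>\<beta>\<in>elts \<alpha>. {x. elts x \<subseteq> elts (V \<beta>)}))"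

definition ord_add :: "'v::zfc \<Rightarrow> 'v \<Rightarrow> 'v"  (infixl "\<oplus>\<^sub>O" 65) where
  "\<alpha> \<oplus>\<^sub>O \<beta> = wfrec mem_rel (\<lambda>f \<beta>. vset (elts \<alpha> \<union> f ` elts \<beta>)) \<beta>"

lemma elts_Vlevel: "elts (Vlevel \<alpha>) = (\<Union>\<beta>\<in>elts \<alpha>. {x. elts x \<subseteq> elts (Vlevel \<beta>)})"
proof -
  have eq: "Vlevel \<alpha> = vset (\<Union>\<beta>\<in>elts \<alpha>. {x. elts x \<subseteq> elts (Vlevel \<beta>)})"
    unfolding Vlevel_def by (subst wfrec[OF wf_mem_rel]) (simp add: cut_apply)
  obtain p where p: "\<And>\<beta>::'a. elts (p \<beta>) = {x. elts x \<subseteq> elts (Vlevel \<beta>)}"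
    using powerset by metis
  obtain z where "elts z = p ` elts \<alpha>" using replacement by blast
  then obtain u where "elts u = (\<Union>\<beta>\<in>elts \<alpha>. elts (p \<beta>))" using union[of z] by auto
  then have "elts u = (\<Union>\<beta>\<in>elts \<alpha>. {x. elts x \<subseteq> elts (Vlevel \<beta>)})" by (simp add: p)
  then show ?thesis using eq by (metis vset_elts)
qed

lemma elts_ord_add: "elts (\<alpha> \<oplus>\<^sub>O \<beta>) = elts \<alpha> \<union> (\<lambda>\<gamma>. \<alpha> \<oplus>\<^sub>O \<gamma>) ` elts \<beta>"
proof -
  have eq: "\<alpha> \<oplus>\<^sub>O \<beta> = vset (elts \<alpha> \<union> (\<lambda>\<gamma>. \<alpha> \<oplus>\<^sub>O \<gamma>) ` elts \<beta>)"
    unfolding ord_add_def by (subst wfrec[OF wf_mem_rel]) (simp add: cut_apply)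
  obtain z where z: "elts z = (\<lambda>\<gamma>. \<alpha> \<oplus>\<^sub>O \<gamma>) ` elts \<beta>" using replacement by blast
  obtain q where "elts q = {\<alpha>, z}" using pairing by blast
  then obtain u where "elts u = elts \<alpha> \<union> elts z" using union[of q] by auto
  then show ?thesis using eq z by (metis vset_elts)
qed


definition Card :: "'v::zfc \<Rightarrow> bool" where
  "Card \<kappa> \<longleftrightarrow> Ord \<kappa> \<and> (\<forall>\<alpha>\<in>elts \<kappa>. elts \<alpha> \<prec> elts \<kappa>)"

definition unbounded_in :: "'v::zfc \<Rightarrow> 'v set \<Rightarrow> bool" where
  "unbounded_in \<alpha> X \<longleftrightarrow> (\<forall>\<beta>\<in>elts \<alpha>. \<exists>\<gamma>\<in>X. elts \<beta> \<subseteq> elts \<gamma>)"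

definition regular_card :: "'v::zfc \<Rightarrow> bool" where
  "regular_card \<kappa> \<longleftrightarrow> Card \<kappa> \<and> infinite (elts \<kappa>) \<and>
     (\<forall>X. X \<subseteq> elts \<kappa> \<and> unbounded_in \<kappa> X \<longrightarrow> X \<approx> elts \<kappa>)"

definition strong_limit :: "'v::zfc \<Rightarrow> bool" where
  "strong_limit \<kappa> \<longleftrightarrow> Card \<kappa> \<and> (\<forall>\<alpha>\<in>elts \<kappa>. Pow (elts \<alpha>) \<prec> elts \<kappa>)"

definition inaccessible :: "'v::zfc \<Rightarrow> bool" where
  "inaccessible \<kappa> \<longleftrightarrow> uncountable (elts \<kappa>) \<and> regular_card \<kappa> \<and> strong_limit \<kappa>"

definition club_in :: "'v::zfc \<Rightarrow> 'v set \<Rightarrow> bool" where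
  "club_in \<pi> C \<longleftrightarrow> C \<subseteq> elts \<pi> \<and> unbounded_in \<pi> C \<and>
     (\<forall>\<alpha>\<in>elts \<pi>. Limit \<alpha> \<and> unbounded_in \<alpha> (C \<inter> elts \<alpha>) \<longrightarrow> \<alpha> \<in> C)"

definition stationary_in :: "'v::zfc \<Rightarrow> 'v set \<Rightarrow> bool" where
  "stationary_in \<pi> S \<longleftrightarrow> S \<subseteq> elts \<pi> \<and> (\<forall>C. club_in \<pi> C \<longrightarrow> S \<inter> C \<noteq> {})"

definition subtle :: "'v::zfc \<Rightarrow> bool" where
  "subtle \<pi> \<longleftrightarrow> Card \<pi> \<and>
     (\<forall>S :: 'v \<Rightarrow> 'v set. \<forall>C. (\<forall>\<alpha>\<in>elts \<pi>. S \<alpha> \<subseteq> elts \<alpha>) \<and> club_in \<pi> C \<longrightarrow>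
        (\<exists>\<beta>\<in>C. \<exists>\<delta>\<in>C. \<beta> \<in> elts \<delta> \<and> S \<delta> \<inter> elts \<beta> = S \<beta>))"


text \<open>First-order formulas over \<open>\<in>\<close>, \<open>=\<close> and two unary predicate symbols, with variables named by
  natural numbers.\<close>

datatype fm =
    Mem nat nat
  | Equal nat nat
  | PredP nat
  | PredA nat
  | Neg fm
  | Conj fm fm
  | Forall nat fm

fun free_vars :: "fm \<Rightarrow> nat set" where
  "free_vars (Mem i j) = {i, j}"
| "free_vars (Equal i j) = {i, j}"
| "free_vars (PredP i) = {i}"
| "free_vars (PredA i) = {i}"
| "free_vars (Neg \<phi>) = free_vars \<phi>"
| "free_vars (Conj \<phi> \<psi>) = free_vars \<phi> \<union> free_vars \<psi>"
| "free_vars (Forall i \<phi>) = free_vars \<phi> - {i}"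

text \<open>Truth in the structure \<open>(M, \<in>, P, A)\<close> under a variable assignment.\<close>

fun sat :: "'v::zfc set \<Rightarrow> 'v set \<Rightarrow> 'v set \<Rightarrow> (nat \<Rightarrow> 'v) \<Rightarrow> fm \<Rightarrow> bool" where
  "sat M P A e (Mem i j) \<longleftrightarrow> e i \<in> elts (e j)"
| "sat M P A e (Equal i j) \<longleftrightarrow> e i = e j"
| "sat M P A e (PredP i) \<longleftrightarrow> e i \<in> P"
| "sat M P A e (PredA i) \<longleftrightarrow> e i \<in> A"
| "sat M P A e (Neg \<phi>) \<longleftrightarrow> \<not> sat M P A e \<phi>"
| "sat M P A e (Conj \<phi> \<psi>) \<longleftrightarrow> sat M P A e \<phi> \<and> sat M P A e \<psi>"
| "sat M P A e (Forall i \<phi>) \<longleftrightarrow> (\<forall>a\<in>M. sat M P A (e(i := a)) \<phi>)"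

text \<open>A formula \<open>\<phi>(x)\<close> is one whose only free variable is variable \<open>0\<close>; the constant assignment
  with value \<open>\<kappa>\<close> then evaluates \<open>\<phi>(\<kappa>)\<close>. The parameter \<open>\<eta>\<close> is meant to be an ordinal \<open>> 0\<close>, so that
  \<open>\<kappa>\<close> is an element of the structure.\<close>

definition shrewd :: "'v::zfc set \<Rightarrow> 'v \<Rightarrow> 'v \<Rightarrow> bool" where
  "shrewd A \<eta> \<kappa> \<longleftrightarrow> Card \<kappa> \<and>
     (\<forall>P \<phi>. P \<subseteq> elts (Vlevel \<kappa>) \<and> free_vars \<phi> \<subseteq> {0} \<and>
        sat (elts (Vlevel (\<kappa> \<oplus>\<^sub>O \<eta>))) P (A \<inter> elts (Vlevel (\<kappa> \<oplus>\<^sub>O \<eta>))) (\<lambda>_. \<kappa>) \<phi> \<longrightarrow>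
        (\<exists>\<kappa>\<^sub>0\<in>elts \<kappa>. \<exists>\<eta>\<^sub>0\<in>elts \<kappa>. elts \<kappa>\<^sub>0 \<noteq> {} \<and> elts \<eta>\<^sub>0 \<noteq> {} \<and>
           sat (elts (Vlevel (\<kappa>\<^sub>0 \<oplus>\<^sub>O \<eta>\<^sub>0))) (P \<inter> elts (Vlevel \<kappa>\<^sub>0))
             (A \<inter> elts (Vlevel (\<kappa>\<^sub>0 \<oplus>\<^sub>O \<eta>\<^sub>0))) (\<lambda>_. \<kappa>\<^sub>0) \<phi>))"

definition shrewd_below :: "'v::zfc set \<Rightarrow> 'v \<Rightarrow> 'v \<Rightarrow> bool" where
  "shrewd_below A \<pi> \<kappa> \<longleftrightarrow> Card \<kappa> \<and> (\<forall>\<eta>\<in>elts \<pi>. elts \<eta> \<noteq> {} \<longrightarrow> shrewd A \<eta> \<kappa>)"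

end

theory Submission
  imports Defs
begin

text \<open>
  Write \<open>S \<alpha>\<close> for the members of a sequence with \<open>S \<alpha> \<subseteq> \<alpha>\<close>, and call \<open>\<beta> < \<delta>\<close> coherent if
  \<open>S \<delta> \<inter> \<beta> = S \<beta>\<close>. Shrewdness of \<open>\<delta>\<close> is reflection of the pair \<open>(\<delta>, P)\<close> to a pair \<open>(\<beta>, P \<inter> V\<^sub>\<beta>)\<close>,
  so a coherent pair is an instance of reflection, and both implications exploit this.

  Subtlety gives shrewd cardinals (\<open>subtle_imp_shrewd\<close>). Suppose that no cardinal in a club \<open>C\<close> is
  \<open>A\<close>-\<open><\<pi>\<close>-shrewd, and choose for each cardinal \<open>\<kappa> \<in> C\<close> a failure: some \<open>\<eta> \<kappa> < \<pi>\<close>, \<open>P \<kappa> \<subseteq> V\<^sub>\<kappa>\<close> and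
  formula \<open>\<phi> \<kappa>\<close> that holds at \<open>(\<kappa>, \<eta> \<kappa>)\<close> but at no pair of nonzero ordinals below \<open>\<kappa>\<close>. As \<open>|V\<^sub>\<pi>| = \<pi>\<close>, there
  is an injective coding of sets in \<open>V\<^sub>\<pi>\<close> and of formulas by ordinals below \<open>\<pi>\<close>; let \<open>S \<kappa>\<close> be the set of
  codes of \<open>\<phi> \<kappa>\<close> and of the members of \<open>P \<kappa>\<close>. On a club of cardinals \<open>\<kappa> \<in> C\<close> this is a subset
  of \<open>\<kappa>\<close>, every member of \<open>V\<^sub>\<kappa>\<close> has its code below \<open>\<kappa>\<close>, and \<open>\<kappa>\<close> is closed under \<open>\<eta>\<close>. For a
  coherent pair \<open>\<beta> < \<delta>\<close> in this club, decoding yields \<open>\<phi> \<beta> = \<phi> \<delta>\<close> and \<open>P \<beta> = P \<delta> \<inter> V\<^sub>\<beta>\<close>, whereas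
  \<open>\<eta> \<beta> < \<delta>\<close>. So what holds at \<open>(\<beta>, \<eta> \<beta>)\<close> reflects the formula of \<open>\<delta>\<close> below \<open>\<delta>\<close>, a contradiction.

  Conversely (\<open>shrewd_imp_subtle\<close>), given a sequence \<open>S\<close> and a club \<open>C\<close>, put
  \<open>A = {S \<alpha> \<union> {\<alpha>} | \<alpha> \<in> C}\<close>. If \<open>\<kappa> \<in> C\<close> is \<open>A\<close>-\<open>2\<close>-shrewd, then with \<open>P = S \<kappa>\<close> the structure
  on \<open>V\<^bsub>\<kappa>+2\<^esub>\<close> satisfies \<open>P \<union> {\<kappa>} \<in> A\<close>. Reflecting this to some \<open>\<kappa>\<^sub>0 < \<kappa>\<close> gives
  \<open>(S \<kappa> \<inter> \<kappa>\<^sub>0) \<union> {\<kappa>\<^sub>0} = S \<alpha> \<union> {\<alpha>}\<close> with \<open>\<alpha> \<in> C\<close>. Comparing largest elements, \<open>\<alpha> = \<kappa>\<^sub>0\<close>, and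
  hence \<open>S \<kappa> \<inter> \<kappa>\<^sub>0 = S \<kappa>\<^sub>0\<close>.
\<close>

section \<open>Ordinals and levels of the cumulative hierarchy\<close>

lemma mem_asym: "x \<in> elts y \<Longrightarrow> y \<notin> elts (x::'v::zfc)"
  using wf_asym[OF wf_mem_rel, of x y] by simp

lemma Ord_trans: "\<lbrakk>Ord \<alpha>; \<beta> \<in> elts \<alpha>; \<gamma> \<in> elts \<beta>\<rbrakk> \<Longrightarrow> \<gamma> \<in> elts \<alpha>"
  unfolding Ord_def by blast

lemma Ord_in_Ord: "\<lbrakk>Ord \<alpha>; \<beta> \<in> elts \<alpha>\<rbrakk> \<Longrightarrow> Ord \<beta>"
  unfolding Ord_def by blast

lemma Ord_linear:
  "\<lbrakk>Ord \<alpha>; Ord \<beta>\<rbrakk> \<Longrightarrow> \<alpha> \<in> elts \<beta> \<or> \<alpha> = \<beta> \<or> \<beta> \<in> elts (\<alpha>::'v::zfc)"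
proof (induction \<alpha> arbitrary: \<beta> rule: wf_induct_rule[OF wf_mem_rel])
  case (1 \<alpha>)
  note IH\<alpha> = 1(1) and \<alpha> = 1(2)
  show ?case using 1(3)
  proof (induction \<beta> rule: wf_induct_rule[OF wf_mem_rel])
    case (1 \<beta>)
    note IH\<beta> = 1(1) and \<beta> = 1(2)
    show ?case
    proof (rule ccontr)
      assume incomparable: "\<not> ?case"
      have "\<gamma> \<in> elts \<beta>" if "\<gamma> \<in> elts \<alpha>" for \<gamma>
        using IH\<alpha>[of \<gamma> \<beta>] that incomparable Ord_trans[OF \<alpha>] Ord_in_Ord[OF \<alpha> that] \<beta> by auto
      moreover have "\<gamma> \<in> elts \<alpha>" if "\<gamma> \<in> elts \<beta>" for \<gamma>
        using IH\<beta>[of \<gamma>] that incomparable Ord_trans[OF \<beta>] Ord_in_Ord[OF \<beta> that] by auto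
      ultimately have "\<alpha> = \<beta>" by (intro extensionality) blast
      then show False using incomparable by simp
    qed
  qed
qed

lemma Ord_not_subset_imp_mem:
  "\<lbrakk>Ord \<alpha>; Ord \<beta>; \<not> elts \<alpha> \<subseteq> elts \<beta>\<rbrakk> \<Longrightarrow> \<beta> \<in> elts \<alpha>"
  using Ord_linear[of \<alpha> \<beta>] unfolding Ord_def by blast

lemma elts_Vlevel_mono: "elts \<alpha> \<subseteq> elts \<beta> \<Longrightarrow> elts (Vlevel \<alpha>) \<subseteq> elts (Vlevel \<beta>)"
  unfolding elts_Vlevel[of \<alpha>] elts_Vlevel[of \<beta>] by blast

lemma Vlevel_transitive:
  assumes "x \<in> elts (Vlevel \<alpha>)" "y \<in> elts x"
  shows "y \<in> elts (Vlevel (\<alpha>::'v::zfc))"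
  using assms
proof (induction \<alpha> arbitrary: x y rule: wf_induct_rule[OF wf_mem_rel])
  case (1 \<alpha>)
  from 1(2) obtain \<beta> where \<beta>: "\<beta> \<in> elts \<alpha>" "elts x \<subseteq> elts (Vlevel \<beta>)"
    using elts_Vlevel by blast
  then have "y \<in> elts (Vlevel \<beta>)" using 1(3) by blast
  then have "elts y \<subseteq> elts (Vlevel \<beta>)" using 1(1)[of \<beta> y] \<beta>(1) by auto
  then show ?case using \<beta>(1) elts_Vlevel by blast
qed

lemma Ord_subset_Vlevel: "Ord \<alpha> \<Longrightarrow> elts \<alpha> \<subseteq> elts (Vlevel (\<alpha>::'v::zfc))"
proof (induction \<alpha> rule: wf_induct_rule[OF wf_mem_rel])
  case (1 \<alpha>)
  then show ?case using Ord_in_Ord unfolding elts_Vlevel[of \<alpha>] by fastforce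
qed

lemma not_mem_Vlevel_self: "\<alpha> \<notin> elts (Vlevel (\<alpha>::'v::zfc))"
proof (induction \<alpha> rule: wf_induct_rule[OF wf_mem_rel])
  case (1 \<alpha>)
  then show ?case unfolding elts_Vlevel[of \<alpha>] by auto
qed

text \<open>Ordinals of \<open>V\<^sub>\<beta>\<close> lie below \<open>\<beta>\<close>, so \<open>P \<inter> V\<^sub>\<beta> = P \<inter> \<beta>\<close> for a set \<open>P\<close> of ordinals: this turns the
  restriction of the predicate in the definition of shrewdness into the one in that of subtlety.\<close>

lemma Ord_mem_Vlevel:
  assumes "Ord \<alpha>" "Ord \<beta>" "\<alpha> \<in> elts (Vlevel \<beta>)"
  shows "\<alpha> \<in> elts (\<beta>::'v::zfc)"
proof (rule ccontr)
  assume not_less: "\<alpha> \<notin> elts \<beta>"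
  obtain \<gamma> where \<gamma>: "\<gamma> \<in> elts \<beta>" "elts \<alpha> \<subseteq> elts (Vlevel \<gamma>)"
    using assms(3) elts_Vlevel by blast
  have "\<gamma> \<in> elts \<alpha>"
    using Ord_linear[OF assms(1,2)] not_less \<gamma>(1) Ord_trans[OF assms(1)] by blast
  then show False using \<gamma>(2) not_mem_Vlevel_self by blast
qed

lemma Vlevel_ord_add_mono: "elts (Vlevel \<alpha>) \<subseteq> elts (Vlevel (\<alpha> \<oplus>\<^sub>O \<eta>))"
  by (intro elts_Vlevel_mono) (simp add: elts_ord_add)

lemma ord_add_empty: "elts z = {} \<Longrightarrow> \<alpha> \<oplus>\<^sub>O z = \<alpha>"
  by (intro extensionality) (simp add: elts_ord_add)

lemma mem_ord_add: "elts \<eta> \<noteq> {} \<Longrightarrow> Ord \<eta> \<Longrightarrow> \<alpha> \<in> elts (\<alpha> \<oplus>\<^sub>O \<eta>)"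
proof -
  assume \<eta>: "elts \<eta> \<noteq> {}" "Ord \<eta>"
  \<comment> \<open>A membership-minimal element of a nonzero ordinal is \<open>0\<close>.\<close>
  obtain z where z: "z \<in> elts \<eta>" "elts z \<inter> elts \<eta> = {}" using foundation[OF \<eta>(1)] by blast
  then have "elts z = {}" using Ord_trans[OF \<eta>(2)] by blast
  then show ?thesis using z(1) ord_add_empty[of z \<alpha>] unfolding elts_ord_add[of \<alpha> \<eta>] by force
qed

lemma Ord_mem_Vlevel_ord_add:
  assumes "Ord \<alpha>" "Ord \<eta>" "elts \<eta> \<noteq> {}"
  shows "\<alpha> \<in> elts (Vlevel (\<alpha> \<oplus>\<^sub>O \<eta>))"
  using Ord_subset_Vlevel[OF assms(1)] mem_ord_add[OF assms(3,2)] elts_Vlevel by blast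

section \<open>Bounded subsets of a regular cardinal\<close>

lemma regular_card_Ord: "regular_card \<pi> \<Longrightarrow> Ord \<pi>"
  unfolding regular_card_def Card_def by blast

lemma regular_card_infinite: "regular_card \<pi> \<Longrightarrow> infinite (elts \<pi>)"
  unfolding regular_card_def by blast

lemma inaccessible_regular: "inaccessible \<pi> \<Longrightarrow> regular_card \<pi>"
  unfolding inaccessible_def by blast

lemma regular_card_bounded:
  assumes "regular_card \<pi>" "X \<subseteq> elts \<pi>" "\<not> X \<approx> elts \<pi>"
  obtains \<gamma> where "\<gamma> \<in> elts \<pi>" "X \<subseteq> elts \<gamma>"
proof -
  have "\<not> unbounded_in \<pi> X" using assms unfolding regular_card_def by blast
  then obtain \<gamma> where \<gamma>: "\<gamma> \<in> elts \<pi>" "\<And>\<xi>. \<xi> \<in> X \<Longrightarrow> \<not> elts \<gamma> \<subseteq> elts \<xi>"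
    unfolding unbounded_in_def by blast
  have "X \<subseteq> elts \<gamma>"
    using \<gamma> assms(2) Ord_not_subset_imp_mem Ord_in_Ord[OF regular_card_Ord[OF assms(1)]] by blast
  then show thesis using \<gamma>(1) that by blast
qed

lemma regular_card_bounded_finite:
  assumes "regular_card \<pi>" "X \<subseteq> elts \<pi>" "finite X"
  obtains \<gamma> where "\<gamma> \<in> elts \<pi>" "X \<subseteq> elts \<gamma>"
  using regular_card_bounded[OF assms(1,2)] assms(3) regular_card_infinite[OF assms(1)]
    eqpoll_finite_iff by blast

lemma regular_card_bounded_image:
  assumes "regular_card \<pi>" "\<alpha> \<in> elts \<pi>" "f ` elts \<alpha> \<subseteq> elts \<pi>"
  obtains \<gamma> where "\<gamma> \<in> elts \<pi>" "f ` elts \<alpha> \<subseteq> elts \<gamma>"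
proof -
  have "elts \<alpha> \<prec> elts \<pi>" using assms(1,2) unfolding regular_card_def Card_def by blast
  then have "f ` elts \<alpha> \<prec> elts \<pi>" using image_lepoll lesspoll_trans1 by blast
  then show thesis using regular_card_bounded[OF assms(1,3)] that unfolding lesspoll_def by blast
qed

lemma inaccessible_bounded_countable:
  assumes "inaccessible \<pi>" "X \<subseteq> elts \<pi>" "countable X"
  obtains \<gamma> where "\<gamma> \<in> elts \<pi>" "X \<subseteq> elts \<gamma>"
  using regular_card_bounded[OF inaccessible_regular[OF assms(1)] assms(2)] assms(1,3)
    countable_eqpoll[of X] eqpoll_sym unfolding inaccessible_def by blast

section \<open>Small sets below an inaccessible cardinal\<close>

text \<open>An injection into \<open>\<pi>\<close> from a set of smaller size has bounded range, by regularity.\<close>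

lemma inaccessible_lepoll_if_lesspoll:
  assumes "inaccessible \<pi>" "X \<prec> elts \<pi>"
  obtains \<gamma> where "\<gamma> \<in> elts \<pi>" "X \<lesssim> elts \<gamma>"
proof -
  obtain f where f: "inj_on f X" "f ` X \<subseteq> elts \<pi>"
    using assms(2) unfolding lesspoll_def lepoll_def by blast
  have "f ` X \<prec> elts \<pi>" using image_lepoll assms(2) lesspoll_trans1 by blast
  then obtain \<gamma> where "\<gamma> \<in> elts \<pi>" "f ` X \<subseteq> elts \<gamma>"
    using regular_card_bounded[OF inaccessible_regular[OF assms(1)] f(2)]
    unfolding lesspoll_def by blast
  then show thesis using f(1) that unfolding lepoll_def by blast
qed

lemma inaccessible_infinite_element:
  assumes "inaccessible \<pi>"
  obtains \<gamma> where "\<gamma> \<in> elts \<pi>" "infinite (elts \<gamma>)"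
proof -
  obtain f :: "nat \<Rightarrow> 'a" where f: "inj f" "range f \<subseteq> elts \<pi>"
    using regular_card_infinite[OF inaccessible_regular[OF assms]] infinite_countable_subset by blast
  obtain \<gamma> where "\<gamma> \<in> elts \<pi>" "range f \<subseteq> elts \<gamma>"
    using inaccessible_bounded_countable[OF assms f(2)] by auto
  then show thesis using range_inj_infinite[OF f(1)] finite_subset that by blast
qed

text \<open>Strong limits absorb power sets, and regularity absorbs the union: the sizes of the sets
  \<open>Pow V\<^sub>\<beta>\<close> for \<open>\<beta> < \<alpha>\<close> have a common infinite bound \<open>\<gamma> < \<pi>\<close>, which also bounds their union.\<close>

lemma inaccessible_Vlevel_small:
  assumes \<pi>: "inaccessible (\<pi>::'v::zfc)" and "\<alpha> \<in> elts \<pi>"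
  shows "\<exists>\<gamma>\<in>elts \<pi>. elts (Vlevel \<alpha>) \<lesssim> elts \<gamma>"
  using assms(2)
proof (induction \<alpha> rule: wf_induct_rule[OF wf_mem_rel])
  case (1 \<alpha>)
  have reg: "regular_card \<pi>" using inaccessible_regular[OF \<pi>] .
  note Ord\<pi> = regular_card_Ord[OF reg]
  have "\<exists>\<gamma>\<in>elts \<pi>. {x. elts x \<subseteq> elts (Vlevel \<beta>)} \<lesssim> elts \<gamma>" if "\<beta> \<in> elts \<alpha>" for \<beta>
  proof -
    have "\<beta> \<in> elts \<pi>" using that 1(2) Ord_trans[OF Ord\<pi>] by blast
    then have "\<exists>\<gamma>\<in>elts \<pi>. elts (Vlevel \<beta>) \<lesssim> elts \<gamma>" using 1(1)[of \<beta>] that by simp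
    then obtain \<gamma> where \<gamma>: "\<gamma> \<in> elts \<pi>" "elts (Vlevel \<beta>) \<lesssim> elts \<gamma>" by blast
    have "inj_on elts {x. elts x \<subseteq> elts (Vlevel \<beta>)}" by (meson extensionality inj_onI)
    then have "{x. elts x \<subseteq> elts (Vlevel \<beta>)} \<lesssim> Pow (elts (Vlevel \<beta>))"
      unfolding lepoll_def by blast
    also have "\<dots> \<lesssim> Pow (elts \<gamma>)"
    proof -
      obtain f where "inj_on f (elts (Vlevel \<beta>))" "f ` elts (Vlevel \<beta>) \<subseteq> elts \<gamma>"
        using \<gamma>(2) unfolding lepoll_def by blast
      then show ?thesis unfolding lepoll_def
        by (intro exI[of _ "image f"]) (auto intro: inj_on_image_Pow)
    qed
    also have "\<dots> \<prec> elts \<pi>" using \<pi> \<gamma>(1) unfolding inaccessible_def strong_limit_def by blast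
    finally show ?thesis using inaccessible_lepoll_if_lesspoll[OF \<pi>] by metis
  qed
  then obtain f where f: "\<And>\<beta>. \<beta> \<in> elts \<alpha> \<Longrightarrow>
      f \<beta> \<in> elts \<pi> \<and> {x. elts x \<subseteq> elts (Vlevel \<beta>)} \<lesssim> elts (f \<beta>)" by metis
  obtain \<gamma>1 where \<gamma>1: "\<gamma>1 \<in> elts \<pi>" "f ` elts \<alpha> \<subseteq> elts \<gamma>1"
    using regular_card_bounded_image[OF reg 1(2), of f] f by blast
  obtain \<gamma>2 where \<gamma>2: "\<gamma>2 \<in> elts \<pi>" "infinite (elts \<gamma>2)"
    using inaccessible_infinite_element[OF \<pi>] .
  obtain \<gamma> where \<gamma>: "\<gamma> \<in> elts \<pi>" "{\<gamma>1, \<gamma>2, \<alpha>} \<subseteq> elts \<gamma>"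
    using regular_card_bounded_finite[OF reg, of "{\<gamma>1, \<gamma>2, \<alpha>}"] \<gamma>1(1) \<gamma>2(1) 1(2) by auto
  have sub: "elts \<xi> \<subseteq> elts \<gamma>" if "\<xi> \<in> elts \<gamma>" for \<xi>
    using that Ord_in_Ord[OF Ord\<pi> \<gamma>(1)] Ord_trans by blast
  have "infinite (elts \<gamma>)" using sub[of \<gamma>2] \<gamma>2(2) \<gamma>(2) finite_subset by blast
  moreover have "elts \<alpha> \<lesssim> elts \<gamma>" using sub[of \<alpha>] \<gamma>(2) subset_imp_lepoll by blast
  moreover have "{x. elts x \<subseteq> elts (Vlevel \<beta>)} \<lesssim> elts \<gamma>" if "\<beta> \<in> elts \<alpha>" for \<beta>
  proof -
    have "f \<beta> \<in> elts \<gamma>" using sub[of \<gamma>1] \<gamma>(2) \<gamma>1(2) that by blast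
    then show ?thesis using f[OF that] sub[of "f \<beta>"] subset_imp_lepoll lepoll_trans by blast
  qed
  ultimately have "(\<Union>\<beta>\<in>elts \<alpha>. {x. elts x \<subseteq> elts (Vlevel \<beta>)}) \<lesssim> elts \<gamma>"
    unfolding lepoll_def card_of_ordLeq by (intro card_of_UNION_ordLeq_infinite) auto
  then show ?case using \<gamma>(1) unfolding elts_Vlevel[of \<alpha>] by blast
qed

lemma inaccessible_succ_mem:
  assumes "inaccessible \<pi>" "\<alpha> \<in> elts \<pi>"
  obtains \<sigma> where "\<sigma> \<in> elts \<pi>" "elts \<sigma> = insert \<alpha> (elts \<alpha>)"
proof -
  note reg = inaccessible_regular[OF assms(1)]
  obtain \<gamma> where \<gamma>: "\<gamma> \<in> elts \<pi>" "\<alpha> \<in> elts \<gamma>"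
    using regular_card_bounded_finite[OF reg, of "{\<alpha>}"] assms(2) by auto
  have Ord\<gamma>: "Ord \<gamma>" using Ord_in_Ord[OF regular_card_Ord[OF reg] \<gamma>(1)] .
  then have sub: "insert \<alpha> (elts \<alpha>) \<subseteq> elts \<gamma>" using \<gamma>(2) Ord_trans by blast
  then obtain \<sigma> where \<sigma>: "elts \<sigma> = insert \<alpha> (elts \<alpha>)" using separation by blast
  have Ord\<sigma>: "Ord \<sigma>" using Ord_in_Ord[OF Ord\<gamma> \<gamma>(2)] unfolding Ord_def \<sigma> by blast
  have "\<sigma> \<in> elts \<pi>"
    using Ord_linear[OF Ord\<sigma> regular_card_Ord[OF reg]] \<gamma>(1) sub \<sigma> not_mem_self mem_asym
    by (metis Ord_trans[OF Ord\<sigma>] subsetD)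
  then show thesis using \<sigma> that by blast
qed

lemma inaccessible_subsets_Vlevel_small:
  assumes "inaccessible \<pi>" "\<alpha> \<in> elts \<pi>"
  shows "\<exists>\<gamma>\<in>elts \<pi>. {x. elts x \<subseteq> elts (Vlevel \<alpha>)} \<lesssim> elts \<gamma>"
proof -
  obtain \<sigma> where \<sigma>: "\<sigma> \<in> elts \<pi>" "elts \<sigma> = insert \<alpha> (elts \<alpha>)"
    using inaccessible_succ_mem[OF assms] .
  have "{x. elts x \<subseteq> elts (Vlevel \<alpha>)} \<lesssim> elts (Vlevel \<sigma>)"
    using elts_Vlevel[of \<sigma>] \<sigma>(2) by (intro subset_imp_lepoll) blast
  then show ?thesis using inaccessible_Vlevel_small[OF assms(1) \<sigma>(1)] lepoll_trans by blast
qed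

lemma mem_imp_subset_inaccessible:
  "\<lbrakk>inaccessible \<pi>; \<gamma> \<in> elts \<pi>\<rbrakk> \<Longrightarrow> elts \<gamma> \<subseteq> elts \<pi>"
  using regular_card_Ord[OF inaccessible_regular] Ord_trans by blast

lemma inaccessible_Vlevel_lepoll:
  assumes "inaccessible \<pi>"
  shows "elts (Vlevel \<pi>) \<lesssim> elts \<pi>"
proof -
  have "{x. elts x \<subseteq> elts (Vlevel \<beta>)} \<lesssim> elts \<pi>" if "\<beta> \<in> elts \<pi>" for \<beta>
    using inaccessible_subsets_Vlevel_small[OF assms that] lepoll_trans
      subset_imp_lepoll[OF mem_imp_subset_inaccessible[OF assms]] by blast
  then show ?thesis
    using regular_card_infinite[OF inaccessible_regular[OF assms]]
    unfolding lepoll_def card_of_ordLeq elts_Vlevel[of \<pi>]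
    by (intro card_of_UNION_ordLeq_infinite) (auto simp: card_of_mono1)
qed

text \<open>An ordinal \<open>\<kappa>\<close> that contains such a \<open>\<gamma>\<close> for each \<open>\<alpha> < \<kappa>\<close> is a cardinal; this is how closure
  points are made cardinals below.\<close>

lemma inaccessible_larger_size:
  assumes "inaccessible \<pi>" "\<alpha> \<in> elts \<pi>"
  shows "\<exists>\<gamma>\<in>elts \<pi>. \<not> elts \<gamma> \<lesssim> elts \<alpha>"
proof -
  have "Pow (elts \<alpha>) \<prec> elts \<pi>"
    using assms unfolding inaccessible_def strong_limit_def by blast
  then obtain \<gamma> where \<gamma>: "\<gamma> \<in> elts \<pi>" "Pow (elts \<alpha>) \<lesssim> elts \<gamma>"
    using inaccessible_lepoll_if_lesspoll[OF assms(1)] by blast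
  have "\<not> elts \<gamma> \<lesssim> elts \<alpha>"
    using \<gamma>(2) lesspoll_Pow_self[of "elts \<alpha>"] lepoll_trans lesspoll_trans2 lesspoll_not_refl by metis
  then show ?thesis using \<gamma>(1) by blast
qed

section \<open>Closure points form a club\<close>

text \<open>Above any ordinal there is a closure point, namely the supremum of an \<open>\<omega>\<close>-sequence in which
  each term bounds witnesses for everything below the previous term; it stays below \<open>\<pi>\<close> because
  \<open>\<pi>\<close> is regular and uncountable. Choosing \<open>Q\<close> as a conjunction of conditions that are upward closed
  in \<open>\<gamma>\<close> intersects several such clubs at once; with \<open>Q \<alpha> \<gamma>\<close> saying that a given club meets the
  interval between \<open>\<alpha>\<close> and \<open>\<gamma>\<close>, the closure points belong to that club.\<close>

lemma closure_points_club:
  assumes \<pi>: "inaccessible (\<pi>::'v::zfc)"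
    and Q: "\<And>\<alpha>. \<alpha> \<in> elts \<pi> \<Longrightarrow> \<exists>\<gamma>\<in>elts \<pi>. Q \<alpha> \<gamma>"
  shows "club_in \<pi> {\<delta>\<in>elts \<pi>. Limit \<delta> \<and> (\<forall>\<alpha>\<in>elts \<delta>. \<exists>\<gamma>\<in>elts \<delta>. Q \<alpha> \<gamma>)}"
    (is "club_in \<pi> ?D")
proof -
  have reg: "regular_card \<pi>" using inaccessible_regular[OF \<pi>] .
  note Ord\<pi> = regular_card_Ord[OF reg]
  have unb: "\<exists>\<delta>\<in>?D. elts \<beta> \<subseteq> elts \<delta>" if \<beta>: "\<beta> \<in> elts \<pi>" for \<beta>
  proof -
    obtain f where f: "\<And>\<alpha>. \<alpha> \<in> elts \<pi> \<Longrightarrow> f \<alpha> \<in> elts \<pi> \<and> Q \<alpha> (f \<alpha>)" using Q by metis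
    have "\<exists>\<gamma>\<in>elts \<pi>. \<alpha> \<in> elts \<gamma> \<and> f ` elts \<alpha> \<subseteq> elts \<gamma>" if \<alpha>: "\<alpha> \<in> elts \<pi>" for \<alpha>
    proof -
      obtain \<gamma>1 where \<gamma>1: "\<gamma>1 \<in> elts \<pi>" "f ` elts \<alpha> \<subseteq> elts \<gamma>1"
        using regular_card_bounded_image[OF reg \<alpha>, of f] f Ord_trans[OF Ord\<pi> \<alpha>] by blast
      obtain \<gamma> where \<gamma>: "\<gamma> \<in> elts \<pi>" "{\<gamma>1, \<alpha>} \<subseteq> elts \<gamma>"
        using regular_card_bounded_finite[OF reg, of "{\<gamma>1, \<alpha>}"] \<gamma>1(1) \<alpha> by auto
      then show ?thesis using \<gamma>1(2) Ord_trans[OF Ord_in_Ord[OF Ord\<pi> \<gamma>(1)]] by blast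
    qed
    then obtain g where g: "\<And>\<alpha>. \<alpha> \<in> elts \<pi> \<Longrightarrow>
        g \<alpha> \<in> elts \<pi> \<and> \<alpha> \<in> elts (g \<alpha>) \<and> f ` elts \<alpha> \<subseteq> elts (g \<alpha>)" by metis
    define b where "b n = (g ^^ n) \<beta>" for n
    have b\<pi>: "b n \<in> elts \<pi>" for n by (induction n) (simp_all add: b_def \<beta> g)
    have bSuc: "b n \<in> elts (b (Suc n))" "f ` elts (b n) \<subseteq> elts (b (Suc n))" for n
      using g[OF b\<pi>[of n]] by (simp_all add: b_def)
    obtain \<gamma> where \<gamma>: "\<gamma> \<in> elts \<pi>" "range b \<subseteq> elts \<gamma>"
      using inaccessible_bounded_countable[OF \<pi>, of "range b"] b\<pi> by auto
    have "(\<Union>n. elts (b n)) \<subseteq> elts \<gamma>"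
      using \<gamma> Ord_trans[OF Ord_in_Ord[OF Ord\<pi> \<gamma>(1)]] by blast
    then obtain \<delta> where \<delta>: "elts \<delta> = (\<Union>n. elts (b n))" using separation by blast
    have Ordb: "Ord (b n)" for n using Ord_in_Ord[OF Ord\<pi> b\<pi>] .
    have Ord\<delta>: "Ord \<delta>"
      unfolding Ord_def
    proof (intro conjI ballI)
      fix \<xi> assume "\<xi> \<in> elts \<delta>"
      then obtain n where n: "\<xi> \<in> elts (b n)" unfolding \<delta> by (rule UN_E)
      then show "elts \<xi> \<subseteq> elts \<delta>" unfolding \<delta> using Ord_trans[OF Ordb[of n]] by blast
      show "elts \<zeta> \<subseteq> elts \<xi>" if "\<zeta> \<in> elts \<xi>" for \<zeta>
        using Ord_trans[OF Ord_in_Ord[OF Ordb n]] that by blast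
    qed
    have "\<delta> \<in> elts \<pi>"
      using Ord_linear[OF Ord\<delta> Ord\<pi>] \<open>(\<Union>n. elts (b n)) \<subseteq> elts \<gamma>\<close> \<delta> \<gamma>(1) not_mem_self
        mem_asym Ord_trans[OF Ord\<delta>] by (metis subsetD)
    moreover have "Limit \<delta>"
    proof -
      have b\<delta>: "b n \<in> elts \<delta>" for n unfolding \<delta> using bSuc(1)[of n] by (rule UN_I[OF UNIV_I])
      have "\<exists>\<gamma>\<in>elts \<delta>. \<xi> \<in> elts \<gamma>" if \<xi>: "\<xi> \<in> elts \<delta>" for \<xi>
      proof -
        obtain n where "\<xi> \<in> elts (b n)" using \<xi> unfolding \<delta> by (rule UN_E)
        then show ?thesis using b\<delta>[of n] by (rule bexI)
      qed
      moreover have "elts \<delta> \<noteq> {}" using b\<delta>[of 0] by blast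
      ultimately show ?thesis unfolding Limit_def using Ord\<delta> by simp
    qed
    moreover have "\<exists>\<gamma>\<in>elts \<delta>. Q \<alpha> \<gamma>" if \<alpha>: "\<alpha> \<in> elts \<delta>" for \<alpha>
    proof -
      obtain n where n: "\<alpha> \<in> elts (b n)" using \<alpha> unfolding \<delta> by (rule UN_E)
      then have "f \<alpha> \<in> elts (b (Suc n))" using bSuc(2)[of n] by blast
      then have "f \<alpha> \<in> elts \<delta>" unfolding \<delta> by (rule UN_I[OF UNIV_I])
      then show ?thesis using f[OF Ord_trans[OF Ord\<pi> b\<pi>[of n] n]] by blast
    qed
    moreover have "elts \<beta> \<subseteq> elts \<delta>"
      unfolding \<delta> using UN_upper[of 0 UNIV "\<lambda>n. elts (b n)"] by (simp add: b_def)
    ultimately show ?thesis by blast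
  qed
  have "\<exists>\<gamma>\<in>elts \<delta>. Q \<alpha> \<gamma>"
    if \<delta>: "Limit \<delta>" "unbounded_in \<delta> (?D \<inter> elts \<delta>)" "\<alpha> \<in> elts \<delta>" for \<delta> \<alpha>
  proof -
    obtain \<beta> where "\<beta> \<in> elts \<delta>" "\<alpha> \<in> elts \<beta>" using \<delta>(1,3) unfolding Limit_def by blast
    then obtain \<epsilon> where "\<epsilon> \<in> ?D" "\<epsilon> \<in> elts \<delta>" "\<alpha> \<in> elts \<epsilon>"
      using \<delta>(2) unfolding unbounded_in_def by blast
    then show ?thesis using \<delta>(1) Ord_trans unfolding Limit_def by blast
  qed
  then show ?thesis using unb unfolding club_in_def unbounded_in_def by blast
qed

section \<open>Subtlety yields shrewd cardinals\<close>

instance fm :: countable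
  by countable_datatype

text \<open>The disjoint sum keeps codes of sets apart from codes of formulas, so that a set of ordinals can
  record a subset of \<open>V\<^sub>\<pi>\<close> together with a formula. It injects into \<open>\<pi>\<close> because \<open>|V\<^sub>\<pi>| \<le> \<pi>\<close> and
  formulas are countable.\<close>

lemma inaccessible_coding:
  assumes "inaccessible (\<pi>::'v::zfc)"
  obtains G :: "'v::zfc + fm \<Rightarrow> 'v"
  where "inj_on G (elts (Vlevel \<pi>) <+> UNIV)" "G ` (elts (Vlevel \<pi>) <+> UNIV) \<subseteq> elts \<pi>"
proof -
  have inf: "infinite (elts \<pi>)" using regular_card_infinite[OF inaccessible_regular[OF assms]] .
  have "(UNIV :: fm set) \<lesssim> (UNIV :: nat set)"
    unfolding lepoll_def using inj_to_nat by blast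
  also have "\<dots> \<lesssim> elts \<pi>" using inf infinite_le_lepoll by blast
  finally have "elts (Vlevel \<pi>) <+> (UNIV :: fm set) \<lesssim> elts \<pi> <+> elts \<pi>"
    using inaccessible_Vlevel_lepoll[OF assms] sum_lepoll_mono by blast
  also have "\<dots> \<approx> elts \<pi>"
    unfolding eqpoll_iff_card_of_ordIso by (intro card_of_Plus_infinite1 inf card_of_mono1 order_refl)
  finally have "elts (Vlevel \<pi>) <+> (UNIV :: fm set) \<lesssim> elts \<pi>" .
  then show thesis using that unfolding lepoll_def by blast
qed

theorem subtle_imp_shrewd:
  fixes \<pi> :: "'v::zfc"
  assumes \<pi>: "inaccessible \<pi>" and "subtle \<pi>" and C: "club_in \<pi> C"
  shows "\<exists>\<kappa>\<in>C. shrewd_below A \<pi> \<kappa>"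
proof (rule ccontr)
  assume none: "\<not> ?thesis"
  have reg: "regular_card \<pi>" using inaccessible_regular[OF \<pi>] .
  note Ord\<pi> = regular_card_Ord[OF reg]
  define holds where "holds P \<kappa> \<eta> \<phi> \<longleftrightarrow>
    sat (elts (Vlevel (\<kappa> \<oplus>\<^sub>O \<eta>))) P (A \<inter> elts (Vlevel (\<kappa> \<oplus>\<^sub>O \<eta>))) (\<lambda>_. \<kappa>) \<phi>" for P \<kappa> \<eta> \<phi>
  define failure where "failure \<kappa> \<eta> P \<phi> \<longleftrightarrow>
      \<eta> \<in> elts \<pi> \<and> elts \<eta> \<noteq> {} \<and> P \<subseteq> elts (Vlevel \<kappa>) \<and> holds P \<kappa> \<eta> \<phi> \<and>
      (\<forall>\<kappa>0\<in>elts \<kappa>. \<forall>\<eta>0\<in>elts \<kappa>. elts \<kappa>0 \<noteq> {} \<longrightarrow> elts \<eta>0 \<noteq> {} \<longrightarrow>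
        \<not> holds (P \<inter> elts (Vlevel \<kappa>0)) \<kappa>0 \<eta>0 \<phi>)" for \<kappa> \<eta> P \<phi>
  have "\<exists>\<eta> P \<phi>. failure \<kappa> \<eta> P \<phi>" if \<kappa>: "\<kappa> \<in> C" "Card \<kappa>" for \<kappa>
  proof -
    obtain \<eta> where \<eta>: "\<eta> \<in> elts \<pi>" "elts \<eta> \<noteq> {}" "\<not> shrewd A \<eta> \<kappa>"
      using none \<kappa> unfolding shrewd_below_def by blast
    then show ?thesis
      using \<kappa>(2) unfolding shrewd_def failure_def holds_def by blast
  qed
  then obtain \<eta> P \<phi> where "\<And>\<kappa>. \<kappa> \<in> C \<Longrightarrow> Card \<kappa> \<Longrightarrow> failure \<kappa> (\<eta> \<kappa>) (P \<kappa>) (\<phi> \<kappa>)"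
    by metis
  note witness = this[unfolded failure_def]
  obtain G :: "'v + fm \<Rightarrow> 'v" where
    G: "inj_on G (elts (Vlevel \<pi>) <+> UNIV)" "G ` (elts (Vlevel \<pi>) <+> UNIV) \<subseteq> elts \<pi>"
    using inaccessible_coding[OF \<pi>] .
  \<comment> \<open>The five clauses make a closure point a limit of \<open>C\<close>, a cardinal, a point at which the coding
    of \<open>V\<^sub>\<kappa>\<close> and of the formulas stays below \<open>\<kappa>\<close>, and a point closed under \<open>\<eta>\<close>.\<close>
  define Q where "Q \<alpha> \<gamma> \<longleftrightarrow> (\<exists>c\<in>C. \<alpha> \<in> elts c \<and> c \<in> elts \<gamma>) \<and> \<not> elts \<gamma> \<lesssim> elts \<alpha> \<and>
    (\<forall>x. elts x \<subseteq> elts (Vlevel \<alpha>) \<longrightarrow> G (Inl x) \<in> elts \<gamma>) \<and> (\<forall>\<psi>. G (Inr \<psi>) \<in> elts \<gamma>) \<and>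
    (\<alpha> \<in> C \<and> Card \<alpha> \<longrightarrow> \<eta> \<alpha> \<in> elts \<gamma>)" for \<alpha> \<gamma>
  have Q: "\<exists>\<gamma>\<in>elts \<pi>. Q \<alpha> \<gamma>" if \<alpha>: "\<alpha> \<in> elts \<pi>" for \<alpha>
  proof -
    obtain \<alpha>' where \<alpha>': "\<alpha>' \<in> elts \<pi>" "elts \<alpha>' = insert \<alpha> (elts \<alpha>)"
      using inaccessible_succ_mem[OF \<pi> \<alpha>] .
    then obtain c where c: "c \<in> C" "\<alpha> \<in> elts c"
      using C unfolding club_in_def unbounded_in_def by blast
    have c\<pi>: "c \<in> elts \<pi>" using c(1) C unfolding club_in_def by blast
    obtain \<gamma>1 where \<gamma>1: "\<gamma>1 \<in> elts \<pi>" "\<not> elts \<gamma>1 \<lesssim> elts \<alpha>"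
      using inaccessible_larger_size[OF \<pi> \<alpha>] by blast
    let ?X = "{x. elts x \<subseteq> elts (Vlevel \<alpha>)}"
    have X: "?X \<subseteq> elts (Vlevel \<pi>)" using \<alpha> unfolding elts_Vlevel[of \<pi>] by blast
    obtain \<gamma>2 where \<gamma>2: "\<gamma>2 \<in> elts \<pi>" "G ` Inl ` ?X \<subseteq> elts \<gamma>2"
    proof -
      obtain \<mu> where \<mu>: "\<mu> \<in> elts \<pi>" "?X \<lesssim> elts \<mu>"
        using inaccessible_subsets_Vlevel_small[OF \<pi> \<alpha>] by blast
      have "elts \<mu> \<prec> elts \<pi>" using reg \<mu>(1) unfolding regular_card_def Card_def by blast
      then have "G ` Inl ` ?X \<prec> elts \<pi>"
        using \<mu>(2) image_lepoll lepoll_trans lesspoll_trans1 by metis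
      moreover have "G ` Inl ` ?X \<subseteq> elts \<pi>" using G(2) X by blast
      ultimately show thesis using regular_card_bounded[OF reg] that unfolding lesspoll_def by metis
    qed
    obtain \<gamma>3 where \<gamma>3: "\<gamma>3 \<in> elts \<pi>" "range (\<lambda>\<psi>. G (Inr \<psi>)) \<subseteq> elts \<gamma>3"
      using inaccessible_bounded_countable[OF \<pi>, of "range (\<lambda>\<psi>. G (Inr \<psi>))"] G(2)
      by (metis InrI UNIV_I countableI_type countable_image image_subset_iff)
    define h where "h = (if \<alpha> \<in> C \<and> Card \<alpha> then \<eta> \<alpha> else \<alpha>)"
    have h: "h \<in> elts \<pi>" using witness \<alpha> by (simp add: h_def)
    obtain \<gamma> where \<gamma>: "\<gamma> \<in> elts \<pi>" "{c, \<gamma>1, \<gamma>2, \<gamma>3, h} \<subseteq> elts \<gamma>"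
      using regular_card_bounded_finite[OF reg, of "{c, \<gamma>1, \<gamma>2, \<gamma>3, h}"]
        c\<pi> \<gamma>1(1) \<gamma>2(1) \<gamma>3(1) h by auto
    have sub: "elts \<gamma>1 \<subseteq> elts \<gamma>" "elts \<gamma>2 \<subseteq> elts \<gamma>" "elts \<gamma>3 \<subseteq> elts \<gamma>"
      using \<gamma>(2) Ord_trans[OF Ord_in_Ord[OF Ord\<pi> \<gamma>(1)]] by blast+
    have "\<not> elts \<gamma> \<lesssim> elts \<alpha>" using \<gamma>1(2) sub(1) subset_imp_lepoll lepoll_trans by blast
    moreover have "\<alpha> \<in> C \<and> Card \<alpha> \<longrightarrow> \<eta> \<alpha> \<in> elts \<gamma>" using \<gamma>(2) h_def by auto
    moreover have "\<exists>c\<in>C. \<alpha> \<in> elts c \<and> c \<in> elts \<gamma>" using c \<gamma>(2) by blast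
    moreover have "\<forall>x. elts x \<subseteq> elts (Vlevel \<alpha>) \<longrightarrow> G (Inl x) \<in> elts \<gamma>"
      using sub(2) \<gamma>2(2) by blast
    moreover have "\<forall>\<psi>. G (Inr \<psi>) \<in> elts \<gamma>" using sub(3) \<gamma>3(2) by blast
    ultimately have "Q \<alpha> \<gamma>" unfolding Q_def by (intro conjI)
    then show ?thesis using \<gamma>(1) by blast
  qed
  define D where "D = {\<delta>\<in>elts \<pi>. Limit \<delta> \<and> (\<forall>\<alpha>\<in>elts \<delta>. \<exists>\<gamma>\<in>elts \<delta>. Q \<alpha> \<gamma>)}"
  have D: "club_in \<pi> D" unfolding D_def by (rule closure_points_club[OF \<pi> Q])
  have D\<pi>: "\<kappa> \<in> elts \<pi>" and D_nonempty: "elts \<kappa> \<noteq> {}" and D_Q: "\<alpha> \<in> elts \<kappa> \<Longrightarrow> \<exists>\<gamma>\<in>elts \<kappa>. Q \<alpha> \<gamma>"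
    and D_Ord: "Ord \<kappa>" if "\<kappa> \<in> D" for \<kappa> \<alpha>
    using that unfolding D_def Limit_def by blast+
  have D_below: "\<lbrakk>\<kappa> \<in> D; \<gamma> \<in> elts \<kappa>; \<xi> \<in> elts \<gamma>\<rbrakk> \<Longrightarrow> \<xi> \<in> elts \<kappa>" for \<kappa> \<gamma> \<xi>
    using D_Ord Ord_trans by blast
  have D_C: "\<kappa> \<in> C" if \<kappa>: "\<kappa> \<in> D" for \<kappa>
  proof -
    have "unbounded_in \<kappa> (C \<inter> elts \<kappa>)"
      unfolding unbounded_in_def
    proof
      fix \<beta> assume "\<beta> \<in> elts \<kappa>"
      then obtain \<gamma> c where "\<gamma> \<in> elts \<kappa>" "c \<in> C" "\<beta> \<in> elts c" "c \<in> elts \<gamma>"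
        using D_Q[OF \<kappa>] unfolding Q_def by blast
      moreover from this have "c \<in> elts \<kappa>" using D_below[OF \<kappa>] by blast
      ultimately show "\<exists>\<gamma>\<in>C \<inter> elts \<kappa>. elts \<beta> \<subseteq> elts \<gamma>"
        using Ord_trans[OF Ord_in_Ord[OF D_Ord[OF \<kappa>]]] by blast
    qed
    then show ?thesis using C \<kappa> unfolding club_in_def D_def by blast
  qed
  have D_Card: "Card \<kappa>" if \<kappa>: "\<kappa> \<in> D" for \<kappa>
    unfolding Card_def
  proof (intro conjI ballI D_Ord[OF \<kappa>])
    fix \<alpha> assume \<alpha>: "\<alpha> \<in> elts \<kappa>"
    then obtain \<gamma> where \<gamma>: "\<gamma> \<in> elts \<kappa>" "\<not> elts \<gamma> \<lesssim> elts \<alpha>"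
      using D_Q[OF \<kappa>] unfolding Q_def by blast
    have sub: "elts \<gamma> \<subseteq> elts \<kappa>" "elts \<alpha> \<subseteq> elts \<kappa>" using D_below[OF \<kappa>] \<alpha> \<gamma>(1) by blast+
    then have "\<not> elts \<kappa> \<lesssim> elts \<alpha>" using \<gamma>(2) subset_imp_lepoll lepoll_trans by blast
    then show "elts \<alpha> \<prec> elts \<kappa>"
      using subset_imp_lepoll[OF sub(2)] eqpoll_sym eqpoll_imp_lepoll unfolding lesspoll_def by blast
  qed
  have D_code_set: "G (Inl x) \<in> elts \<kappa>" if \<kappa>: "\<kappa> \<in> D" and x: "x \<in> elts (Vlevel \<kappa>)" for \<kappa> x
  proof -
    obtain \<alpha> where "\<alpha> \<in> elts \<kappa>" "elts x \<subseteq> elts (Vlevel \<alpha>)" using x elts_Vlevel by blast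
    then show ?thesis using D_Q[OF \<kappa>] D_below[OF \<kappa>] unfolding Q_def by blast
  qed
  have D_code_fm: "G (Inr \<psi>) \<in> elts \<kappa>" if "\<kappa> \<in> D" for \<kappa> \<psi>
    using D_nonempty[OF that] D_Q[OF that] D_below[OF that] unfolding Q_def by blast
  have D_\<eta>: "\<eta> \<beta> \<in> elts \<kappa>" if "\<kappa> \<in> D" "\<beta> \<in> D" "\<beta> \<in> elts \<kappa>" for \<kappa> \<beta>
    using D_Q[OF that(1,3)] D_below[OF that(1)] D_C[OF that(2)] D_Card[OF that(2)]
    unfolding Q_def by blast
  note fails = witness[OF D_C D_Card]
  have D_P: "P \<kappa> \<subseteq> elts (Vlevel \<kappa>)" if "\<kappa> \<in> D" for \<kappa>
    using fails[OF that that] by blast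
  have V\<pi>: "elts (Vlevel \<kappa>) \<subseteq> elts (Vlevel \<pi>)" if "\<kappa> \<in> D" for \<kappa>
    using elts_Vlevel_mono[OF mem_imp_subset_inaccessible[OF \<pi> D\<pi>[OF that]]] .
  define S where "S \<kappa> = (if \<kappa> \<in> D then G ` (P \<kappa> <+> {\<phi> \<kappa>}) else {})" for \<kappa>
  have "S \<alpha> \<subseteq> elts \<alpha>" for \<alpha>
  proof (cases "\<alpha> \<in> D")
    case True
    then show ?thesis
      using D_P[OF True] D_code_set[OF True] D_code_fm[OF True] unfolding S_def by auto
  qed (simp add: S_def)
  then obtain \<beta> \<delta> where \<beta>\<delta>: "\<beta> \<in> D" "\<delta> \<in> D" "\<beta> \<in> elts \<delta>" "S \<delta> \<inter> elts \<beta> = S \<beta>"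
    using \<open>subtle \<pi>\<close> D unfolding subtle_def by blast
  have S_set: "G (Inl x) \<in> S \<kappa> \<longleftrightarrow> x \<in> P \<kappa>" if "\<kappa> \<in> D" "x \<in> elts (Vlevel \<pi>)" for \<kappa> x
  proof -
    have "P \<kappa> <+> {\<phi> \<kappa>} \<subseteq> elts (Vlevel \<pi>) <+> UNIV" using D_P[OF that(1)] V\<pi>[OF that(1)] by blast
    then show ?thesis
      using that inj_on_image_mem_iff[OF G(1), of "Inl x" "P \<kappa> <+> {\<phi> \<kappa>}"]
      unfolding S_def by auto
  qed
  have S_fm: "G (Inr \<psi>) \<in> S \<kappa> \<longleftrightarrow> \<psi> = \<phi> \<kappa>" if "\<kappa> \<in> D" for \<kappa> \<psi>
  proof -
    have "P \<kappa> <+> {\<phi> \<kappa>} \<subseteq> elts (Vlevel \<pi>) <+> UNIV" using D_P[OF that] V\<pi>[OF that] by blast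
    then show ?thesis
      using that inj_on_image_mem_iff[OF G(1), of "Inr \<psi>" "P \<kappa> <+> {\<phi> \<kappa>}"]
      unfolding S_def by auto
  qed
  \<comment> \<open>Codes of formulas and of members of \<open>V\<^sub>\<beta>\<close> lie below \<open>\<beta>\<close>, where \<open>S \<beta>\<close> and \<open>S \<delta>\<close> agree.\<close>
  have "\<phi> \<beta> = \<phi> \<delta>" using S_fm[OF \<beta>\<delta>(1)] S_fm[OF \<beta>\<delta>(2)] \<beta>\<delta>(4) by blast
  moreover have "P \<beta> = P \<delta> \<inter> elts (Vlevel \<beta>)"
  proof -
    have "x \<in> P \<beta> \<longleftrightarrow> x \<in> P \<delta>" if x: "x \<in> elts (Vlevel \<beta>)" for x
    proof -
      have "x \<in> elts (Vlevel \<pi>)" using V\<pi>[OF \<beta>\<delta>(1)] x by blast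
      then have "x \<in> P \<beta> \<longleftrightarrow> G (Inl x) \<in> S \<beta>" "x \<in> P \<delta> \<longleftrightarrow> G (Inl x) \<in> S \<delta>"
        using S_set \<beta>\<delta>(1,2) by blast+
      then show ?thesis using D_code_set[OF \<beta>\<delta>(1) x] \<beta>\<delta>(4) by blast
    qed
    then show ?thesis using D_P[OF \<beta>\<delta>(1)] by blast
  qed
  moreover have "holds (P \<beta>) \<beta> (\<eta> \<beta>) (\<phi> \<beta>)" "elts (\<eta> \<beta>) \<noteq> {}"
    using fails[OF \<beta>\<delta>(1) \<beta>\<delta>(1)] by blast+
  ultimately show False
    using fails[OF \<beta>\<delta>(2) \<beta>\<delta>(2)] \<beta>\<delta>(3) D_nonempty[OF \<beta>\<delta>(1)] D_\<eta>[OF \<beta>\<delta>(2,1,3)] by metis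
qed

section \<open>Shrewd cardinals yield subtlety\<close>

text \<open>The formula \<open>\<exists>x. x \<in> A \<and> x = P \<union> {\<kappa>}\<close>, with \<open>\<kappa>\<close>, \<open>x\<close> and the members of \<open>x\<close> as the variables
  \<open>0\<close>, \<open>1\<close> and \<open>2\<close>; the two inclusions of the equality are separate conjuncts.\<close>

definition fm_extension_in_A :: fm where
  "fm_extension_in_A = Neg (Forall 1 (Neg (Conj (PredA 1)
     (Forall 2 (Conj
       (Neg (Conj (Mem 2 1) (Conj (Neg (PredP 2)) (Neg (Equal 2 0)))))
       (Neg (Conj (Neg (Conj (Neg (PredP 2)) (Neg (Equal 2 0)))) (Neg (Mem 2 1)))))))))"

lemma free_vars_fm_extension_in_A: "free_vars fm_extension_in_A \<subseteq> {0}"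
  by (auto simp: fm_extension_in_A_def)

lemma sat_fm_extension_in_A:
  assumes "\<And>x y. x \<in> M \<Longrightarrow> y \<in> elts x \<Longrightarrow> y \<in> M" "P \<subseteq> M" "\<kappa> \<in> M"
  shows "sat M P A (\<lambda>_. \<kappa>) fm_extension_in_A \<longleftrightarrow> (\<exists>x\<in>M. x \<in> A \<and> elts x = insert \<kappa> P)"
proof -
  have "sat M P A (\<lambda>_. \<kappa>) fm_extension_in_A \<longleftrightarrow>
      (\<exists>x\<in>M. x \<in> A \<and> (\<forall>y\<in>M. y \<in> elts x \<longleftrightarrow> y \<in> P \<or> y = \<kappa>))"
    by (auto simp: fm_extension_in_A_def)
  also have "\<dots> \<longleftrightarrow> (\<exists>x\<in>M. x \<in> A \<and> elts x = insert \<kappa> P)"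
    using assms by blast
  finally show ?thesis .
qed

theorem shrewd_imp_subtle:
  fixes \<pi> :: "'v::zfc"
  assumes \<pi>: "inaccessible \<pi>"
    and stat: "\<And>A. A \<subseteq> elts (Vlevel \<pi>) \<Longrightarrow>
      stationary_in \<pi> {\<kappa> \<in> elts \<pi>. shrewd_below A \<pi> \<kappa>}"
  shows "subtle \<pi>"
  unfolding subtle_def
proof (intro conjI allI impI)
  show "Card \<pi>" using inaccessible_regular[OF \<pi>] unfolding regular_card_def by blast
next
  fix S :: "'v \<Rightarrow> 'v set" and C
  assume SC: "(\<forall>\<alpha>\<in>elts \<pi>. S \<alpha> \<subseteq> elts \<alpha>) \<and> club_in \<pi> C"
  then have S: "S \<alpha> \<subseteq> elts \<alpha>" if "\<alpha> \<in> elts \<pi>" for \<alpha> using that by blast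
  have C: "club_in \<pi> C" "C \<subseteq> elts \<pi>" using SC unfolding club_in_def by blast+
  have Ord\<pi>: "Ord \<pi>" using regular_card_Ord[OF inaccessible_regular[OF \<pi>]] .
  define A where "A = {x. \<exists>\<alpha>\<in>C. elts x = insert \<alpha> (S \<alpha>)}"
  have "A \<subseteq> elts (Vlevel \<pi>)"
  proof
    fix x assume "x \<in> A"
    then obtain \<alpha> where \<alpha>: "\<alpha> \<in> C" "elts x = insert \<alpha> (S \<alpha>)" unfolding A_def by blast
    then have "\<alpha> \<in> elts \<pi>" using C(2) by blast
    then obtain \<sigma> where \<sigma>: "\<sigma> \<in> elts \<pi>" "elts \<sigma> = insert \<alpha> (elts \<alpha>)"
      using inaccessible_succ_mem[OF \<pi>] by blast
    have "elts x \<subseteq> elts (Vlevel \<sigma>)"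
      using Ord_subset_Vlevel[OF Ord_in_Ord[OF Ord\<pi> \<sigma>(1)]] \<sigma>(2) \<alpha>(2) S[OF \<open>\<alpha> \<in> elts \<pi>\<close>] by blast
    then show "x \<in> elts (Vlevel \<pi>)" using \<sigma>(1) elts_Vlevel by blast
  qed
  from stat[OF this] C(1) obtain \<kappa> where \<kappa>: "\<kappa> \<in> C" "\<kappa> \<in> elts \<pi>" "shrewd_below A \<pi> \<kappa>"
    unfolding stationary_in_def by blast
  have Ord\<kappa>: "Ord \<kappa>" using Ord_in_Ord[OF Ord\<pi> \<kappa>(2)] .
  \<comment> \<open>The ordinals \<open>0\<close>, \<open>1\<close> and \<open>2\<close>; the set \<open>S \<kappa> \<union> {\<kappa>}\<close> first appears in \<open>V\<^bsub>\<kappa>+2\<^esub>\<close>.\<close>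
  obtain z where z: "z \<in> elts \<pi>" "elts z = {}"
    using foundation[of \<pi>] \<kappa>(2) Ord_trans[OF Ord\<pi>] by blast
  obtain one where one: "one \<in> elts \<pi>" "elts one = {z}"
    using inaccessible_succ_mem[OF \<pi> z(1)] z(2) by metis
  obtain two where two: "two \<in> elts \<pi>" "elts two = {one, z}"
    using inaccessible_succ_mem[OF \<pi> one(1)] one(2) by metis
  let ?M = "\<lambda>\<kappa> \<eta>. elts (Vlevel (\<kappa> \<oplus>\<^sub>O \<eta>))"
  have sat_iff: "sat (?M \<kappa>' \<eta>) P (A \<inter> ?M \<kappa>' \<eta>) (\<lambda>_. \<kappa>') fm_extension_in_A \<longleftrightarrow>
      (\<exists>x\<in>?M \<kappa>' \<eta>. x \<in> A \<and> elts x = insert \<kappa>' P)"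
    if "Ord \<kappa>'" "Ord \<eta>" "elts \<eta> \<noteq> {}" "P \<subseteq> elts (Vlevel \<kappa>')" for \<kappa>' \<eta> P
  proof -
    have "P \<subseteq> ?M \<kappa>' \<eta>" using that(4) Vlevel_ord_add_mono by blast
    then show ?thesis
      by (subst sat_fm_extension_in_A)
        (use Vlevel_transitive Ord_mem_Vlevel_ord_add[OF that(1-3)] in blast)+
  qed
  have P: "S \<kappa> \<subseteq> elts (Vlevel \<kappa>)" using S[OF \<kappa>(2)] Ord_subset_Vlevel[OF Ord\<kappa>] by blast
  have Ord2: "Ord two" using Ord_in_Ord[OF Ord\<pi> two(1)] .
  have "\<kappa> \<in> ?M \<kappa> one"
    using Ord_mem_Vlevel_ord_add[OF Ord\<kappa> Ord_in_Ord[OF Ord\<pi> one(1)]] one(2) by blast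
  then have sub: "insert \<kappa> (S \<kappa>) \<subseteq> ?M \<kappa> one" using P Vlevel_ord_add_mono by blast
  then obtain x where x: "elts x = insert \<kappa> (S \<kappa>)" using separation by blast
  have "\<kappa> \<oplus>\<^sub>O one \<in> elts (\<kappa> \<oplus>\<^sub>O two)" unfolding elts_ord_add[of \<kappa> two] two(2) by blast
  then have "x \<in> ?M \<kappa> two" unfolding elts_Vlevel[of "\<kappa> \<oplus>\<^sub>O two"] using sub x by blast
  moreover have "x \<in> A" using x \<kappa>(1) unfolding A_def by blast
  ultimately have "sat (?M \<kappa> two) (S \<kappa>) (A \<inter> ?M \<kappa> two) (\<lambda>_. \<kappa>) fm_extension_in_A"
    using sat_iff[OF Ord\<kappa> Ord2 _ P] two(2) x by blast
  moreover have "shrewd A two \<kappa>" using \<kappa>(3) two unfolding shrewd_below_def by blast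
  ultimately obtain \<kappa>0 \<eta>0 where r: "\<kappa>0 \<in> elts \<kappa>" "\<eta>0 \<in> elts \<kappa>" "elts \<eta>0 \<noteq> {}"
    "sat (?M \<kappa>0 \<eta>0) (S \<kappa> \<inter> elts (Vlevel \<kappa>0)) (A \<inter> ?M \<kappa>0 \<eta>0) (\<lambda>_. \<kappa>0) fm_extension_in_A"
    using P free_vars_fm_extension_in_A unfolding shrewd_def by blast
  then obtain y where "y \<in> A" "elts y = insert \<kappa>0 (S \<kappa> \<inter> elts (Vlevel \<kappa>0))"
    using sat_iff[OF Ord_in_Ord[OF Ord\<kappa> r(1)] Ord_in_Ord[OF Ord\<kappa> r(2)] r(3)] by blast
  then obtain \<alpha> where \<alpha>: "\<alpha> \<in> C" "insert \<alpha> (S \<alpha>) = insert \<kappa>0 (S \<kappa> \<inter> elts (Vlevel \<kappa>0))"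
    unfolding A_def by auto
  show "\<exists>\<beta>\<in>C. \<exists>\<delta>\<in>C. \<beta> \<in> elts \<delta> \<and> S \<delta> \<inter> elts \<beta> = S \<beta>"
  proof (intro bexI conjI)
    have \<alpha>\<pi>: "\<alpha> \<in> elts \<pi>" using \<alpha>(1) C(2) by blast
    have \<kappa>0\<pi>: "\<kappa>0 \<in> elts \<pi>" using Ord_trans[OF Ord\<pi> \<kappa>(2) r(1)] .
    have V: "\<xi> \<in> elts \<kappa>0" if "\<xi> \<in> elts (Vlevel \<kappa>0)" "\<xi> \<in> elts \<pi>" for \<xi>
      using Ord_mem_Vlevel[OF _ _ that(1)] Ord_in_Ord[OF Ord\<pi>] that(2) \<kappa>0\<pi> by blast
    \<comment> \<open>Both are the largest element of the same set of ordinals.\<close>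
    have "\<alpha> = \<kappa>0"
    proof (rule ccontr)
      assume "\<alpha> \<noteq> \<kappa>0"
      have "\<kappa>0 \<in> insert \<alpha> (S \<alpha>)" unfolding \<alpha>(2) by simp
      then have "\<kappa>0 \<in> elts \<alpha>" using \<open>\<alpha> \<noteq> \<kappa>0\<close> S[OF \<alpha>\<pi>] by auto
      moreover have "\<alpha> \<in> insert \<kappa>0 (S \<kappa> \<inter> elts (Vlevel \<kappa>0))" unfolding \<alpha>(2)[symmetric] by simp
      then have "\<alpha> \<in> elts \<kappa>0" using \<open>\<alpha> \<noteq> \<kappa>0\<close> V[OF _ \<alpha>\<pi>] by simp
      ultimately show False using mem_asym[of \<kappa>0 \<alpha>] by blast
    qed
    have "S \<kappa> \<inter> elts (Vlevel \<kappa>0) = S \<kappa> \<inter> elts \<kappa>0"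
    proof -
      have "S \<kappa> \<subseteq> elts \<pi>" using S[OF \<kappa>(2)] mem_imp_subset_inaccessible[OF \<pi> \<kappa>(2)] by blast
      then show ?thesis
        using V Ord_subset_Vlevel[OF Ord_in_Ord[OF Ord\<pi> \<kappa>0\<pi>]] by blast
    qed
    then show "S \<kappa> \<inter> elts \<kappa>0 = S \<kappa>0"
      using \<alpha>(2) S[OF \<kappa>0\<pi>] not_mem_self[of \<kappa>0] insert_ident[of \<kappa>0 "S \<kappa>0" "S \<kappa> \<inter> elts \<kappa>0"]
      unfolding \<open>\<alpha> = \<kappa>0\<close> by auto
    show "\<kappa>0 \<in> elts \<kappa>" "\<kappa> \<in> C" "\<kappa>0 \<in> C" using r(1) \<kappa>(1) \<alpha>(1) \<open>\<alpha> = \<kappa>0\<close> by blast+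
  qed
qed

theorem theorem1p4:
  fixes \<pi> :: "'v::zfc"
  assumes "inaccessible \<pi>"
  shows "subtle \<pi> \<longleftrightarrow>
    (\<forall>A. A \<subseteq> elts (Vlevel \<pi>) \<longrightarrow> stationary_in \<pi> {\<kappa> \<in> elts \<pi>. shrewd_below A \<pi> \<kappa>})"
proof
  assume "subtle \<pi>"
  then show "\<forall>A. A \<subseteq> elts (Vlevel \<pi>) \<longrightarrow> stationary_in \<pi> {\<kappa> \<in> elts \<pi>. shrewd_below A \<pi> \<kappa>}"
    using subtle_imp_shrewd[OF assms] unfolding stationary_in_def club_in_def by blast
next
  assume "\<forall>A. A \<subseteq> elts (Vlevel \<pi>) \<longrightarrow> stationary_in \<pi> {\<kappa> \<in> elts \<pi>. shrewd_below A \<pi> \<kappa>}"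
  then show "subtle \<pi>" using shrewd_imp_subtle[OF assms] by blast
qed

end
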